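(* Let $\mathbb{F}$ be an algebraically closed field of characteristic not equal to $2$, let $V$ be a vector space over $\mathbb{F}$ of countably infinite dimension, let $f:V\to\mathbb{F}$ be a nondegenerate quadratic form, and let $v_i$, $i\in\mathbb{N}$, be an arbitrary orthonormal basis of $V$. A nonzero even derivation $D$ of $\mathcal{C}\ell(V,f)$ is a Bogolyubov derivation if and only if $$D=\sum_{i<j}\alpha_{ij}\,\mathrm{ad}(v_iv_j),\qquad \alpha_{ij}\in\mathbb{F},$$ where for each $i\in\mathbb{N}$ only finitely many coefficients $\alpha_{ij}$, $i<j$, are nonzero. Moreover, this presentation is unique.
   Context: $\mathbb{N}$ is the set of positive integers. A quadratic form on $V$ is a map $f:V\to\mathbb{F}$ with $f(\lambda v)=\lambda^2 f(v)$ such that $f(v,w)=f(v+w)-f(v)-f(w)$ is bilinear; it is nondegenerate if the bilinear form $f(v,w)$ is nondegenerate. The Clifford algebra $\mathcal{C}\ell(V,f)$ is the unital associative $\mathbb{F}$-algebra generated by $V$ with defining relations $v^2=f(v)\cdot 1$, $v\in V$. It is $\mathbb{Z}/2\mathbb{Z}$-graded: $\mathcal{C}\ell(V,f)_{\overline{0}}$ is the span of $1$ and all products of an even number of elements of $V$, and $\mathcal{C}\ell(V,f)_{\overline{1}}$ is the span of all products of an odd number of elements of $V$. A basis $v_i$, $i\in\mathbb{N}$, is orthonormal if $v_iv_j+v_jv_i=2\delta_{ij}$ in $\mathcal{C}\ell(V,f)$ for all $i,j$. A derivation means an ordinary ($\mathbb{F}$-linear, ungraded Leibniz rule) derivation;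 it is even if $D(\mathcal{C}\ell(V,f)_{\overline{0}})\subseteq\mathcal{C}\ell(V,f)_{\overline{0}}$ and $D(\mathcal{C}\ell(V,f)_{\overline{1}})\subseteq\mathcal{C}\ell(V,f)_{\overline{1}}$. A linear map $\psi:V\to V$ is skew-symmetric if $f(\psi(v),w)+f(v,\psi(w))=0$ for all $v,w\in V$; each such $\psi$ extends uniquely to a derivation of $\mathcal{C}\ell(V,f)$, and the derivations so obtained are called Bogolyubov derivations. $\mathrm{ad}(a)$ is the inner derivation $x\mapsto [a,x]=ax-xa$. The (possibly infinite) sum is over pairs $i<j$ in $\mathbb{N}$ and is understood pointwise: for every $a\in\mathcal{C}\ell(V,f)$ only finitely many terms $\alpha_{ij}\,\mathrm{ad}(v_iv_j)(a)$ are nonzero, and $D(a)$ is the sum of these. *)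

theory Defs
  imports
    "HOL-Algebra.Algebraic_Closure_Type"
    "HOL-Library.Countable_Set"
    "HOL-Library.Poly_Mapping"
begin

section \<open>Free algebras\<close>

text \<open>
  Words in the letters \<open>'v\<close> under concatenation, written additively because the monoid-algebra
  product on \<open>'m \<Rightarrow>\<^sub>0 'k\<close> is defined by the library for \<open>'m :: monoid_add\<close>. Hence
  \<open>'v free_monoid \<Rightarrow>\<^sub>0 'k\<close> is the free unital associative \<open>'k\<close>-algebra on the set \<open>'v\<close>.
\<close>

datatype 'a free_monoid = Word (letters: "'a list")

instantiation free_monoid :: (type) monoid_add
begin

definition zero_free_monoid :: "'a free_monoid"
  where "0 = Word []"

definition plus_free_monoid :: "'a free_monoid \<Rightarrow> 'a free_monoid \<Rightarrow> 'a free_monoid"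
  where "x + y = Word (letters x @ letters y)"

instance
  by standard (simp_all add: zero_free_monoid_def plus_free_monoid_def)

end

type_synonym ('v, 'k) free_algebra = "'v free_monoid \<Rightarrow>\<^sub>0 'k"

definition free_gen :: "'v \<Rightarrow> ('v, 'k::field) free_algebra"
  where "free_gen v = Poly_Mapping.single (Word [v]) 1"

definition free_const :: "'k::field \<Rightarrow> ('v, 'k) free_algebra"
  where "free_const c = Poly_Mapping.single 0 c"


lemma ring_ring_of_type_algebra: "ring (ring_of_type_algebra :: 'a::ring_1 ring)"
proof -
  have "\<exists>y. x + y = 0" for x :: 'a
    using add.right_inverse by blast
  then show ?thesis
    unfolding ring_of_type_algebra_def using add.right_inverse
    by unfold_locales (auto simp: algebra_simps Units_def)
qed


section \<open>Quadratic forms\<close>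

definition polar_form :: "('v::ab_group_add \<Rightarrow> 'k::field) \<Rightarrow> 'v \<Rightarrow> 'v \<Rightarrow> 'k"
  where "polar_form f v w = f (v + w) - f v - f w"

locale quadratic_space = vector_space scale
  for scale :: "'k::field \<Rightarrow> 'v::ab_group_add \<Rightarrow> 'v" (infixr \<open>*s\<close> 75) +
  fixes f :: "'v \<Rightarrow> 'k"
  assumes homogeneous: "f (c *s v) = c\<^sup>2 * f v"
    and polar_linear_right: "Vector_Spaces.linear scale (*) (\<lambda>w. polar_form f v w)"
    and polar_linear_left: "Vector_Spaces.linear scale (*) (\<lambda>v. polar_form f v w)"
begin

definition nondegenerate :: bool
  where "nondegenerate \<longleftrightarrow> (\<forall>v. (\<forall>w. polar_form f v w = 0) \<longrightarrow> v = 0)"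

definition countably_infinite_dimensional :: bool
  where "countably_infinite_dimensional \<longleftrightarrow>
    (\<exists>B. independent B \<and> span B = UNIV \<and> infinite B \<and> countable B)"

definition skew_symmetric :: "('v \<Rightarrow> 'v) \<Rightarrow> bool"
  where "skew_symmetric \<psi> \<longleftrightarrow> Vector_Spaces.linear scale scale \<psi> \<and>
    (\<forall>v w. polar_form f (\<psi> v) w + polar_form f v (\<psi> w) = 0)"


section \<open>The Clifford algebra\<close>

text \<open>
  The first two families of relations make the canonical map from \<open>V\<close> linear, since the free
  algebra is taken on the underlying set of \<open>V\<close>.
\<close>

definition clifford_relations :: "('v, 'k) free_algebra set"
  where "clifford_relations =
    {free_gen (v + w) - free_gen v - free_gen w | v w. True} \<union>
    {free_gen (c *s v) - free_const c * free_gen v | c v. True} \<union>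
    {free_gen v * free_gen v - free_const (f v) | v. True}"

definition clifford_ideal :: "('v, 'k) free_algebra set"
  where "clifford_ideal = genideal ring_of_type_algebra clifford_relations"

definition Cl :: "('v, 'k) free_algebra set ring"
  where "Cl = ring_of_type_algebra Quot clifford_ideal"

definition proj :: "('v, 'k) free_algebra \<Rightarrow> ('v, 'k) free_algebra set"
  where "proj p = clifford_ideal +>\<^bsub>ring_of_type_algebra\<^esub> p"

abbreviation \<iota> :: "'v \<Rightarrow> ('v, 'k) free_algebra set"
  where "\<iota> v \<equiv> proj (free_gen v)"

abbreviation const :: "'k \<Rightarrow> ('v, 'k) free_algebra set"
  where "const c \<equiv> proj (free_const c)"

definition Cl_scale :: "'k \<Rightarrow> ('v, 'k) free_algebra set \<Rightarrow> ('v, 'k) free_algebra set"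
    (infixr \<open>\<cdot>\<close> 75)
  where "c \<cdot> x = const c \<otimes>\<^bsub>Cl\<^esub> x"

lemma ring_Cl: "ring Cl"
proof -
  interpret R: ring "ring_of_type_algebra :: ('v, 'k) free_algebra ring"
    by (rule ring_ring_of_type_algebra)
  have "ideal clifford_ideal (ring_of_type_algebra :: ('v, 'k) free_algebra ring)"
    unfolding clifford_ideal_def
    by (rule R.genideal_ideal) (simp add: ring_of_type_algebra_def)
  then show ?thesis
    unfolding Cl_def by (rule ideal.quotient_is_ring)
qed

inductive_set Cl_span :: "('v, 'k) free_algebra set set \<Rightarrow> ('v, 'k) free_algebra set set"
  for S
  where
    zero: "\<zero>\<^bsub>Cl\<^esub> \<in> Cl_span S"
  | add_smult: "s \<in> S \<Longrightarrow> x \<in> Cl_span S \<Longrightarrow> c \<cdot> s \<oplus>\<^bsub>Cl\<^esub> x \<in> Cl_span S"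

definition Cl_prod :: "'v list \<Rightarrow> ('v, 'k) free_algebra set"
  where "Cl_prod vs = foldr (\<lambda>v x. \<iota> v \<otimes>\<^bsub>Cl\<^esub> x) vs \<one>\<^bsub>Cl\<^esub>"

definition Cl_even :: "('v, 'k) free_algebra set set"
  where "Cl_even = Cl_span {Cl_prod vs | vs. even (length vs)}"

definition Cl_odd :: "('v, 'k) free_algebra set set"
  where "Cl_odd = Cl_span {Cl_prod vs | vs. odd (length vs)}"

text \<open>
  Bases are indexed by the type \<^typ>\<open>nat\<close>, which stands for the positive integers through the
  order isomorphism \<open>i \<mapsto> i + 1\<close>.
\<close>

definition orthonormal_basis :: "(nat \<Rightarrow> 'v) \<Rightarrow> bool"
  where "orthonormal_basis v \<longleftrightarrow>
    inj v \<and> independent (range v) \<and> span (range v) = UNIV \<and>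
    (\<forall>i j. \<iota> (v i) \<otimes>\<^bsub>Cl\<^esub> \<iota> (v j) \<oplus>\<^bsub>Cl\<^esub> \<iota> (v j) \<otimes>\<^bsub>Cl\<^esub> \<iota> (v i)
       = const (2 * (if i = j then 1 else 0)))"


section \<open>Derivations\<close>

text \<open>
  Endomaps of the Clifford algebra are HOL functions of which only the values on
  \<^term>\<open>carrier Cl\<close> matter.
\<close>

definition derivation ::
    "(('v, 'k) free_algebra set \<Rightarrow> ('v, 'k) free_algebra set) \<Rightarrow> bool"
  where "derivation D \<longleftrightarrow>
    (\<forall>x\<in>carrier Cl. D x \<in> carrier Cl) \<and>
    (\<forall>x\<in>carrier Cl. \<forall>y\<in>carrier Cl. D (x \<oplus>\<^bsub>Cl\<^esub> y) = D x \<oplus>\<^bsub>Cl\<^esub> D y) \<and>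
    (\<forall>c. \<forall>x\<in>carrier Cl. D (c \<cdot> x) = c \<cdot> D x) \<and>
    (\<forall>x\<in>carrier Cl. \<forall>y\<in>carrier Cl.
       D (x \<otimes>\<^bsub>Cl\<^esub> y) = D x \<otimes>\<^bsub>Cl\<^esub> y \<oplus>\<^bsub>Cl\<^esub> x \<otimes>\<^bsub>Cl\<^esub> D y)"

definition even_derivation ::
    "(('v, 'k) free_algebra set \<Rightarrow> ('v, 'k) free_algebra set) \<Rightarrow> bool"
  where "even_derivation D \<longleftrightarrow>
    derivation D \<and> D ` Cl_even \<subseteq> Cl_even \<and> D ` Cl_odd \<subseteq> Cl_odd"

definition bogolyubov ::
    "(('v, 'k) free_algebra set \<Rightarrow> ('v, 'k) free_algebra set) \<Rightarrow> bool"
  where "bogolyubov D \<longleftrightarrow>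
    derivation D \<and> (\<exists>\<psi>. skew_symmetric \<psi> \<and> (\<forall>v. D (\<iota> v) = \<iota> (\<psi> v)))"

definition ad :: "('v, 'k) free_algebra set \<Rightarrow> ('v, 'k) free_algebra set \<Rightarrow>
    ('v, 'k) free_algebra set"
  where "ad a x = a \<otimes>\<^bsub>Cl\<^esub> x \<ominus>\<^bsub>Cl\<^esub> x \<otimes>\<^bsub>Cl\<^esub> a"

definition ad_term :: "(nat \<Rightarrow> 'v) \<Rightarrow> (nat \<Rightarrow> nat \<Rightarrow> 'k) \<Rightarrow> nat \<times> nat \<Rightarrow>
    ('v, 'k) free_algebra set \<Rightarrow> ('v, 'k) free_algebra set"
  where "ad_term v \<alpha> = (\<lambda>(i, j) a. \<alpha> i j \<cdot> ad (\<iota> (v i) \<otimes>\<^bsub>Cl\<^esub> \<iota> (v j)) a)"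

definition ad_support :: "(nat \<Rightarrow> 'v) \<Rightarrow> (nat \<Rightarrow> nat \<Rightarrow> 'k) \<Rightarrow>
    ('v, 'k) free_algebra set \<Rightarrow> (nat \<times> nat) set"
  where "ad_support v \<alpha> a = {(i, j). i < j \<and> ad_term v \<alpha> (i, j) a \<noteq> \<zero>\<^bsub>Cl\<^esub>}"

definition is_ad_sum :: "(nat \<Rightarrow> 'v) \<Rightarrow> (nat \<Rightarrow> nat \<Rightarrow> 'k) \<Rightarrow>
    (('v, 'k) free_algebra set \<Rightarrow> ('v, 'k) free_algebra set) \<Rightarrow> bool"
  where "is_ad_sum v \<alpha> D \<longleftrightarrow>
    (\<forall>a\<in>carrier Cl. finite (ad_support v \<alpha> a) \<and>
       D a = (\<Oplus>\<^bsub>Cl\<^esub>p\<in>ad_support v \<alpha> a. ad_term v \<alpha> p a))"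

end

text \<open>Only the entries \<open>\<alpha> i j\<close> with \<open>i < j\<close> of a coefficient array are meaningful.\<close>

definition row_finite :: "(nat \<Rightarrow> nat \<Rightarrow> 'k::zero) \<Rightarrow> bool"
  where "row_finite \<alpha> \<longleftrightarrow> (\<forall>i. finite {j. i < j \<and> \<alpha> i j \<noteq> 0})"

end

theory Submission
  imports Defs
begin

text \<open>
  Write \<open>\<langle>v, w\<rangle>\<close> for the polar form of \<open>f\<close>. In the Clifford algebra \<open>v w + w v = \<langle>v, w\<rangle>\<close>, and therefore
  \<open>[v w, u] = \<langle>w, u\<rangle> v - \<langle>v, u\<rangle> w\<close> for vectors \<open>u, v, w\<close> (\<open>ad_iota_mult\<close>): inner derivations by products
  of two vectors preserve \<open>V\<close>. With an orthonormal basis, whose vectors satisfy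
  \<open>\<langle>v\<^sub>i, v\<^sub>j\<rangle> = 2 \<delta>\<^bsub>ij\<^esub>\<close>, the derivation \<open>ad (v\<^sub>i v\<^sub>j)\<close> kills every basis vector other than \<open>v\<^sub>i\<close> and \<open>v\<^sub>j\<close>
  and acts on \<open>V\<close> as \<open>v\<^sub>j \<mapsto> 2 v\<^sub>i\<close>, \<open>v\<^sub>i \<mapsto> -2 v\<^sub>j\<close>. The sums in question are thus the expansions of
  infinite skew-symmetric matrices in elementary ones, and everything happens on \<open>V\<close>, because a
  derivation is determined by its values on generators (\<open>is_ad_sum_from_basis\<close>).

  If \<open>D\<close> extends a skew-symmetric \<open>\<psi>\<close>, put \<open>\<alpha>\<^bsub>ij\<^esub> = \<langle>v\<^sub>i, \<psi> v\<^sub>j\<rangle> / 4\<close>. Columns of this matrix are finite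
  since each \<open>\<psi> v\<^sub>j\<close> is a finite combination of basis vectors, and by antisymmetry so are rows; the
  ad-sum agrees with \<open>D\<close> on basis vectors and hence everywhere (\<open>bogolyubov_imp_ad_sum\<close>).
  Conversely an ad-sum maps \<open>V\<close> to \<open>V\<close>, and applying a derivation to \<open>x y + y x = \<langle>x, y\<rangle>\<close> shows that
  its restriction to \<open>V\<close> is skew-symmetric (\<open>ad_sum_imp_bogolyubov\<close>). Uniqueness holds because
  \<open>v\<^sub>i (D v\<^sub>k) + (D v\<^sub>k) v\<^sub>i = 4 \<alpha>\<^bsub>ik\<^esub>\<close> for \<open>i < k\<close> (\<open>ad_sum_coefficient\<close>).

  These arguments read identities in \<open>'k\<close> and \<open>V\<close> off the Clifford algebra, so both must embed in it.
  A nonzero derivation exists only on a nonzero ring, which makes the field of scalars embed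
  (\<open>const_inject\<close>); nondegeneracy then makes \<open>V\<close> embed (\<open>iota_inject\<close>), because anticommutators of
  vectors are scalars that detect the polar form.
\<close>

section \<open>The free algebra\<close>

lemma update_eq_single_plus:
  fixes p :: "'a \<Rightarrow>\<^sub>0 'b::monoid_add"
  assumes "w \<notin> Poly_Mapping.keys p"
  shows "Poly_Mapping.update w b p = Poly_Mapping.single w b + p"
  using assms
  by (intro poly_mapping_eqI)
    (auto simp: lookup_update lookup_add lookup_single in_keys_iff when_def)

text \<open>
  Constants are supported on the empty word, which is neutral on both sides; this makes the image
  of \<open>'k\<close> in the Clifford algebra central.
\<close>

lemma free_const_mult_commute: "free_const c * p = p * free_const (c :: 'k::field)"
proof (induction p rule: update_induct)
  case const
  then show ?case by simp
next
  case (update p w b)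
  then show ?case
    by (simp add: update_eq_single_plus free_const_def mult_single distrib_left distrib_right mult.commute)
qed

text \<open>
  Words are products of letters, so the letters generate the free algebra.
\<close>

lemma free_algebra_induct [case_names const gen add mult]:
  fixes p :: "('v, 'k::field) free_algebra"
  assumes const: "\<And>c. P (free_const c)"
    and gen: "\<And>v. P (free_gen v)"
    and add: "\<And>p q. P p \<Longrightarrow> P q \<Longrightarrow> P (p + q)"
    and mult: "\<And>p q. P p \<Longrightarrow> P q \<Longrightarrow> P (p * q)"
  shows "P p"
proof -
  have single: "P (Poly_Mapping.single (Word vs) c)" for vs c
  proof (induction vs)
    case Nil
    then show ?case using const[of c] by (simp add: free_const_def zero_free_monoid_def)
  next
    case (Cons v vs)
    have "Poly_Mapping.single (Word (v # vs)) c = free_gen v * Poly_Mapping.single (Word vs) c"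
      by (simp add: free_gen_def mult_single plus_free_monoid_def)
    then show ?case using mult[OF gen Cons] by metis
  qed
  show ?thesis
  proof (induction p rule: update_induct)
    case const
    then show ?case using assms(1)[of 0] by (simp add: free_const_def)
  next
    case (update p w b)
    then show ?case
      using add[OF single[of "letters w" b] update.IH] update.hyps
      by (simp add: update_eq_single_plus)
  qed
qed

section \<open>The Clifford algebra as a quotient\<close>

context quadratic_space
begin

interpretation Cl: ring Cl
  by (rule ring_Cl)

lemma ideal_clifford_ideal:
  "ideal clifford_ideal (ring_of_type_algebra :: ('v, 'k) free_algebra ring)"
proof -
  interpret R: ring "ring_of_type_algebra :: ('v, 'k) free_algebra ring"
    by (rule ring_ring_of_type_algebra)
  show ?thesis
    unfolding clifford_ideal_def
    by (rule R.genideal_ideal) (simp add: ring_of_type_algebra_def)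
qed

lemma proj_ring_hom: "ring_hom_ring ring_of_type_algebra Cl proj"
proof -
  have "proj = (\<lambda>p. clifford_ideal +>\<^bsub>ring_of_type_algebra\<^esub> p)"
    by (simp add: proj_def fun_eq_iff)
  then show ?thesis
    unfolding Cl_def using ideal.rcos_ring_hom_ring[OF ideal_clifford_ideal] by simp
qed

interpretation proj: ring_hom_ring ring_of_type_algebra Cl proj
  by (rule proj_ring_hom)

lemma carrier_Cl: "carrier Cl = range proj"
  unfolding Cl_def FactRing_def A_RCOSETS_def' proj_def
  by (auto simp: ring_of_type_algebra_def)

lemma proj_closed [simp]: "proj p \<in> carrier Cl"
  by (simp add: carrier_Cl)

lemma proj_add: "proj p \<oplus>\<^bsub>Cl\<^esub> proj q = proj (p + q)"
  using proj.hom_add[of p q] by (simp add: ring_of_type_algebra_def)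

lemma proj_mult: "proj p \<otimes>\<^bsub>Cl\<^esub> proj q = proj (p * q)"
  using proj.hom_mult[of p q] by (simp add: ring_of_type_algebra_def)

lemma proj_zero: "\<zero>\<^bsub>Cl\<^esub> = proj 0"
  using proj.hom_zero by (simp add: ring_of_type_algebra_def)

lemma proj_one: "\<one>\<^bsub>Cl\<^esub> = const 1"
  using proj.hom_one by (simp add: ring_of_type_algebra_def free_const_def)

lemma proj_minus: "\<ominus>\<^bsub>Cl\<^esub> proj p = proj (- p)"
proof -
  have "proj (- p) \<oplus>\<^bsub>Cl\<^esub> proj p = \<zero>\<^bsub>Cl\<^esub>"
    by (simp add: proj_add proj_zero)
  then show ?thesis by (simp add: Cl.minus_equality)
qed

text \<open>
  With this, an identity between polynomial expressions in \<open>proj p\<close>, \<open>proj q\<close>, \<open>\<dots>\<close> follows from the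
  same identity in the free algebra, where type-class ring arithmetic applies.
\<close>

lemma proj_diff: "proj p \<ominus>\<^bsub>Cl\<^esub> proj q = proj (p - q)"
  by (simp add: a_minus_def proj_minus proj_add)

lemmas proj_simps = proj_add proj_mult proj_minus proj_diff

lemma proj_eqI:
  assumes "p - q \<in> clifford_relations"
  shows "proj p = proj q"
proof -
  interpret I: ideal clifford_ideal "ring_of_type_algebra :: ('v, 'k) free_algebra ring"
    by (rule ideal_clifford_ideal)
  have "clifford_relations \<subseteq> clifford_ideal"
    unfolding clifford_ideal_def
    by (auto simp: genideal_def)
  then have "proj (p - q) = \<zero>\<^bsub>Cl\<^esub>"
    unfolding proj_def Cl_def FactRing_def using assms I.a_rcos_const by auto
  then show ?thesis
    using Cl.r_right_minus_eq[of "proj p" "proj q"] by (simp add: proj_diff)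
qed

lemma Cl_induct [consumes 1, case_names const gen add mult]:
  assumes "x \<in> carrier Cl"
    and const: "\<And>c. P (const c)"
    and gen: "\<And>v. P (\<iota> v)"
    and add: "\<And>x y. \<lbrakk>x \<in> carrier Cl; y \<in> carrier Cl; P x; P y\<rbrakk> \<Longrightarrow> P (x \<oplus>\<^bsub>Cl\<^esub> y)"
    and mult: "\<And>x y. \<lbrakk>x \<in> carrier Cl; y \<in> carrier Cl; P x; P y\<rbrakk> \<Longrightarrow> P (x \<otimes>\<^bsub>Cl\<^esub> y)"
  shows "P x"
proof -
  have "P (proj p)" for p
  proof (induction p rule: free_algebra_induct)
    case (add p q)
    then show ?case using assms(4)[of "proj p" "proj q"] by (simp add: proj_add)
  next
    case (mult p q)
    then show ?case using assms(5)[of "proj p" "proj q"] by (simp add: proj_mult)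
  qed (simp_all add: const gen)
  then show ?thesis using assms(1) by (auto simp: carrier_Cl)
qed

section \<open>Scalars and vectors in the Clifford algebra\<close>

lemma iota_add: "\<iota> (v + w) = \<iota> v \<oplus>\<^bsub>Cl\<^esub> \<iota> w"
  unfolding proj_add
  by (rule proj_eqI) (auto simp: clifford_relations_def diff_diff_eq[symmetric])

lemma iota_scale: "\<iota> (c *s v) = c \<cdot> \<iota> v"
  unfolding Cl_scale_def proj_mult
  by (rule proj_eqI) (auto simp: clifford_relations_def)

lemma iota_square: "\<iota> v \<otimes>\<^bsub>Cl\<^esub> \<iota> v = const (f v)"
  unfolding proj_mult
  by (rule proj_eqI) (auto simp: clifford_relations_def)

lemma const_add: "const (c + d) = const c \<oplus>\<^bsub>Cl\<^esub> const d"
  by (simp add: proj_add free_const_def single_add)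

lemma const_mult: "const (c * d) = const c \<otimes>\<^bsub>Cl\<^esub> const d"
  by (simp add: proj_mult free_const_def mult_single)

lemma const_zero: "const 0 = \<zero>\<^bsub>Cl\<^esub>"
  by (simp add: proj_zero free_const_def)

lemma const_diff: "const (c - d) = const c \<ominus>\<^bsub>Cl\<^esub> const d"
  by (simp add: proj_diff free_const_def single_diff)

lemma const_commute: "x \<in> carrier Cl \<Longrightarrow> const c \<otimes>\<^bsub>Cl\<^esub> x = x \<otimes>\<^bsub>Cl\<^esub> const c"
  by (auto simp: carrier_Cl proj_mult free_const_mult_commute)

text \<open>
  Nonzero scalars are invertible, and a unit vanishes only in the zero ring.
\<close>

lemma const_inject:
  assumes "\<one>\<^bsub>Cl\<^esub> \<noteq> \<zero>\<^bsub>Cl\<^esub>"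
  shows "const c = const d \<longleftrightarrow> c = d"
proof
  assume eq: "const c = const d"
  show "c = d"
  proof (rule ccontr)
    assume "c \<noteq> d"
    then have "\<one>\<^bsub>Cl\<^esub> = const (inverse (c - d)) \<otimes>\<^bsub>Cl\<^esub> const (c - d)"
      by (simp add: proj_one flip: const_mult)
    also have "\<dots> = \<zero>\<^bsub>Cl\<^esub>"
      using eq by (simp add: const_diff a_minus_def Cl.r_neg)
    finally show False using assms by contradiction
  qed
qed simp

text \<open>
  Polarization of \<open>v\<^sup>2 = f v\<close>.
\<close>

lemma iota_anticommutator:
  "\<iota> v \<otimes>\<^bsub>Cl\<^esub> \<iota> w \<oplus>\<^bsub>Cl\<^esub> \<iota> w \<otimes>\<^bsub>Cl\<^esub> \<iota> v = const (polar_form f v w)"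
proof -
  have "\<iota> v \<otimes>\<^bsub>Cl\<^esub> \<iota> w \<oplus>\<^bsub>Cl\<^esub> \<iota> w \<otimes>\<^bsub>Cl\<^esub> \<iota> v
      = \<iota> (v + w) \<otimes>\<^bsub>Cl\<^esub> \<iota> (v + w) \<ominus>\<^bsub>Cl\<^esub> \<iota> v \<otimes>\<^bsub>Cl\<^esub> \<iota> v \<ominus>\<^bsub>Cl\<^esub> \<iota> w \<otimes>\<^bsub>Cl\<^esub> \<iota> w"
    unfolding iota_add proj_simps by (simp add: algebra_simps)
  then show ?thesis
    by (simp add: iota_square polar_form_def const_diff)
qed

lemma iota_zero: "\<iota> 0 = \<zero>\<^bsub>Cl\<^esub>"
  using iota_add[of 0 0] by (metis Cl.add.l_cancel_one' proj_closed add_0)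

lemma scale_closed [simp]: "x \<in> carrier Cl \<Longrightarrow> c \<cdot> x \<in> carrier Cl"
  by (simp add: Cl_scale_def)

lemma iota_minus: "\<iota> (- v) = \<ominus>\<^bsub>Cl\<^esub> \<iota> v"
  using iota_add[of "- v" v] by (simp add: iota_zero Cl.minus_equality)

lemma iota_diff: "\<iota> (v - w) = \<iota> v \<ominus>\<^bsub>Cl\<^esub> \<iota> w"
  using iota_add[of v "- w"] by (simp add: iota_minus a_minus_def)

lemma iota_sum: "\<iota> (sum g A) = (\<Oplus>\<^bsub>Cl\<^esub>a\<in>A. \<iota> (g a))"
  by (induction A rule: infinite_finite_induct) (simp_all add: iota_zero iota_add)

lemma polar_commute: "polar_form f v w = polar_form f w v"
  by (simp add: polar_form_def add.commute)

text \<open>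
  If \<open>\<iota> u = 0\<close>, then \<open>polar_form f u w\<close>, the anticommutator of \<open>\<iota> u\<close> with \<open>\<iota> w\<close>, vanishes for all \<open>w\<close>.
  Nondegeneracy then gives \<open>u = 0\<close>.
\<close>

lemma iota_inject:
  assumes "\<one>\<^bsub>Cl\<^esub> \<noteq> \<zero>\<^bsub>Cl\<^esub>" "nondegenerate"
  shows "\<iota> v = \<iota> w \<longleftrightarrow> v = w"
proof
  assume "\<iota> v = \<iota> w"
  then have zero: "\<iota> (v - w) = \<zero>\<^bsub>Cl\<^esub>"
    by (simp add: iota_diff a_minus_def Cl.r_neg)
  have "const (polar_form f (v - w) u) = const 0" for u
    using iota_anticommutator[of "v - w" u] unfolding zero by (simp add: const_zero)
  then have "polar_form f (v - w) u = 0" for u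
    using assms(1) const_inject by blast
  then have "v - w = 0"
    using assms(2) unfolding nondegenerate_def by blast
  then show "v = w" by simp
qed simp

section \<open>Derivations\<close>

lemma scale_add_right:
  "\<lbrakk>x \<in> carrier Cl; y \<in> carrier Cl\<rbrakk> \<Longrightarrow> c \<cdot> (x \<oplus>\<^bsub>Cl\<^esub> y) = c \<cdot> x \<oplus>\<^bsub>Cl\<^esub> c \<cdot> y"
  by (simp add: Cl_scale_def Cl.r_distr)

lemma scale_mult_left:
  "\<lbrakk>x \<in> carrier Cl; y \<in> carrier Cl\<rbrakk> \<Longrightarrow> (c \<cdot> x) \<otimes>\<^bsub>Cl\<^esub> y = c \<cdot> (x \<otimes>\<^bsub>Cl\<^esub> y)"
  by (simp add: Cl_scale_def Cl.m_assoc)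

lemma scale_mult_right:
  "\<lbrakk>x \<in> carrier Cl; y \<in> carrier Cl\<rbrakk> \<Longrightarrow> x \<otimes>\<^bsub>Cl\<^esub> (c \<cdot> y) = c \<cdot> (x \<otimes>\<^bsub>Cl\<^esub> y)"
  by (metis Cl_scale_def Cl.m_assoc const_commute proj_closed)

lemma scale_scale: "x \<in> carrier Cl \<Longrightarrow> c \<cdot> d \<cdot> x = (c * d) \<cdot> x"
  by (simp add: Cl_scale_def const_mult Cl.m_assoc)

lemma derivation_closed: "\<lbrakk>derivation D; x \<in> carrier Cl\<rbrakk> \<Longrightarrow> D x \<in> carrier Cl"
  by (simp add: derivation_def)

lemma derivation_add:
  "\<lbrakk>derivation D; x \<in> carrier Cl; y \<in> carrier Cl\<rbrakk> \<Longrightarrow> D (x \<oplus>\<^bsub>Cl\<^esub> y) = D x \<oplus>\<^bsub>Cl\<^esub> D y"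
  by (simp add: derivation_def)

lemma derivation_scale: "\<lbrakk>derivation D; x \<in> carrier Cl\<rbrakk> \<Longrightarrow> D (c \<cdot> x) = c \<cdot> D x"
  by (simp add: derivation_def)

lemma derivation_mult:
  "\<lbrakk>derivation D; x \<in> carrier Cl; y \<in> carrier Cl\<rbrakk>
    \<Longrightarrow> D (x \<otimes>\<^bsub>Cl\<^esub> y) = D x \<otimes>\<^bsub>Cl\<^esub> y \<oplus>\<^bsub>Cl\<^esub> x \<otimes>\<^bsub>Cl\<^esub> D y"
  by (simp add: derivation_def)

lemma derivation_const:
  assumes "derivation D"
  shows "D (const c) = \<zero>\<^bsub>Cl\<^esub>"
proof -
  have closed: "D (const 1) \<in> carrier Cl"
    using assms by (simp add: derivation_closed)
  have "D (const 1) = D (const 1) \<oplus>\<^bsub>Cl\<^esub> D (const 1)"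
    using derivation_mult[OF assms proj_closed proj_closed, of "free_const 1" "free_const 1"]
    using closed by (simp flip: proj_one)
  then have "D (const 1) = \<zero>\<^bsub>Cl\<^esub>"
    using closed by (metis Cl.add.l_cancel_one')
  then show ?thesis
    using derivation_scale[OF assms proj_closed, of c "free_const 1"]
    by (simp add: Cl_scale_def flip: const_mult)
qed

lemma derivation_ad:
  assumes "a \<in> carrier Cl"
  shows "derivation (ad a)"
proof -
  obtain r where a: "a = proj r"
    using assms by (auto simp: carrier_Cl)
  have scale: "ad a (c \<cdot> x) = c \<cdot> ad a x" if "x \<in> carrier Cl" for c x
  proof -
    have "r * (free_const c * p) = free_const c * (r * p)" for p
      by (metis free_const_mult_commute mult.assoc)
    then show ?thesis
      using that unfolding carrier_Cl Cl_scale_def ad_def a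
      by (auto simp: proj_simps mult.assoc right_diff_distrib)
  qed
  show ?thesis
    unfolding derivation_def using assms scale
    by (auto simp: ad_def a carrier_Cl proj_simps algebra_simps)
qed

lemma derivation_scaled:
  assumes "derivation D"
  shows "derivation (\<lambda>x. c \<cdot> D x)"
  unfolding derivation_def using assms
  by (auto simp: derivation_closed derivation_add derivation_scale derivation_mult
      scale_add_right scale_mult_left scale_mult_right scale_scale mult.commute)

lemma derivation_ad_term: "derivation (ad_term v \<alpha> p)"
proof -
  obtain i j where "p = (i, j)" by fastforce
  then show ?thesis
    unfolding ad_term_def by (auto intro!: derivation_scaled derivation_ad)
qed

text \<open>
  Expanding \<open>v w u - u v w = v (w u + u w) - (v u + u v) w\<close>: the adjoint action of a product of
  two vectors preserves \<open>V\<close>.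
\<close>

lemma ad_iota_mult:
  "ad (\<iota> v \<otimes>\<^bsub>Cl\<^esub> \<iota> w) (\<iota> u) = \<iota> (polar_form f w u *s v - polar_form f v u *s w)"
proof -
  have "ad (\<iota> v \<otimes>\<^bsub>Cl\<^esub> \<iota> w) (\<iota> u)
     = \<iota> v \<otimes>\<^bsub>Cl\<^esub> (\<iota> w \<otimes>\<^bsub>Cl\<^esub> \<iota> u \<oplus>\<^bsub>Cl\<^esub> \<iota> u \<otimes>\<^bsub>Cl\<^esub> \<iota> w)
       \<ominus>\<^bsub>Cl\<^esub> (\<iota> v \<otimes>\<^bsub>Cl\<^esub> \<iota> u \<oplus>\<^bsub>Cl\<^esub> \<iota> u \<otimes>\<^bsub>Cl\<^esub> \<iota> v) \<otimes>\<^bsub>Cl\<^esub> \<iota> w"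
    unfolding ad_def proj_simps by (simp add: algebra_simps)
  then show ?thesis
    by (simp add: iota_anticommutator iota_diff iota_scale Cl_scale_def const_commute)
qed

section \<open>Locally finite sums of inner derivations\<close>

lemma polar_linear: "Vector_Spaces.linear scale (*) (polar_form f v)"
  using polar_linear_right by simp

interpretation polar: Vector_Spaces.linear scale "(*)" "polar_form f v" for v
  by (rule polar_linear)

text \<open>
  The vector \<open>\<alpha>\<^bsub>ij\<^esub> [v\<^sub>i v\<^sub>j, u]\<close>. Moving it from the Clifford algebra to \<open>V\<close> lets sums of such
  terms be computed with linear algebra in \<open>V\<close>.
\<close>

definition ad_vector :: "(nat \<Rightarrow> 'v) \<Rightarrow> (nat \<Rightarrow> nat \<Rightarrow> 'k) \<Rightarrow> 'v \<Rightarrow> nat \<times> nat \<Rightarrow> 'v"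
  where "ad_vector v \<alpha> u =
    (\<lambda>(i, j). \<alpha> i j *s (polar_form f (v j) u *s v i - polar_form f (v i) u *s v j))"

lemma ad_term_iota: "ad_term v \<alpha> p (\<iota> u) = \<iota> (ad_vector v \<alpha> u p)"
  by (cases p) (simp add: ad_vector_def ad_term_def ad_iota_mult iota_scale)

lemma finsum_ad_term_iota:
  "(\<Oplus>\<^bsub>Cl\<^esub>p\<in>F. ad_term v \<alpha> p (\<iota> u)) = \<iota> (sum (ad_vector v \<alpha> u) F)"
  by (simp add: ad_term_iota iota_sum)

lemma ad_term_closed [simp]: "x \<in> carrier Cl \<Longrightarrow> ad_term v \<alpha> p x \<in> carrier Cl"
  using derivation_ad_term derivation_closed by blast

lemma ad_support_subset_iff:
  "ad_support v \<alpha> a \<subseteq> F \<longleftrightarrow>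
    (\<forall>p. fst p < snd p \<longrightarrow> p \<notin> F \<longrightarrow> ad_term v \<alpha> p a = \<zero>\<^bsub>Cl\<^esub>)"
  unfolding ad_support_def
  by (simp only: subset_iff split_paired_All mem_Collect_eq prod.case fst_conv snd_conv) blast

lemma ad_sum_superset:
  assumes "a \<in> carrier Cl" "finite F" "ad_support v \<alpha> a \<subseteq> F" "F \<subseteq> {(i, j). i < j}"
  shows "(\<Oplus>\<^bsub>Cl\<^esub>p\<in>ad_support v \<alpha> a. ad_term v \<alpha> p a) = (\<Oplus>\<^bsub>Cl\<^esub>p\<in>F. ad_term v \<alpha> p a)"
  using assms by (intro Cl.add.finprod_mono_neutral_cong_left) (auto simp: ad_support_def)

text \<open>
  The index set \<open>F\<close> may exceed the support so that sums at different arguments can be taken over a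
  common set: the supports at \<open>x\<close>, \<open>y\<close>, \<open>x + y\<close> and \<open>x y\<close> differ, but one \<open>F\<close> covers all four.
\<close>

definition has_ad_sum :: "(nat \<Rightarrow> 'v) \<Rightarrow> (nat \<Rightarrow> nat \<Rightarrow> 'k) \<Rightarrow>
    ('v, 'k) free_algebra set \<Rightarrow> ('v, 'k) free_algebra set \<Rightarrow> bool"
  where "has_ad_sum v \<alpha> a b \<longleftrightarrow> (\<exists>F. finite F \<and> ad_support v \<alpha> a \<subseteq> F \<and> F \<subseteq> {(i, j). i < j} \<and>
     b = (\<Oplus>\<^bsub>Cl\<^esub>p\<in>F. ad_term v \<alpha> p a))"

lemma is_ad_sum_iff:
  "is_ad_sum v \<alpha> D \<longleftrightarrow> (\<forall>a\<in>carrier Cl. has_ad_sum v \<alpha> a (D a))"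
proof -
  have "ad_support v \<alpha> a \<subseteq> {(i, j). i < j}" for a
    by (auto simp: ad_support_def)
  then show ?thesis
    unfolding is_ad_sum_def has_ad_sum_def
    by (metis ad_sum_superset finite_subset order_refl)
qed

lemma has_ad_sum_common:
  assumes "x \<in> carrier Cl" "y \<in> carrier Cl" "has_ad_sum v \<alpha> x b" "has_ad_sum v \<alpha> y c"
  obtains F where "finite F" "F \<subseteq> {(i, j). i < j}" "ad_support v \<alpha> x \<subseteq> F" "ad_support v \<alpha> y \<subseteq> F"
    "b = (\<Oplus>\<^bsub>Cl\<^esub>p\<in>F. ad_term v \<alpha> p x)" "c = (\<Oplus>\<^bsub>Cl\<^esub>p\<in>F. ad_term v \<alpha> p y)"
proof -
  obtain G H where
    "finite G" "ad_support v \<alpha> x \<subseteq> G" "G \<subseteq> {(i, j). i < j}" "b = (\<Oplus>\<^bsub>Cl\<^esub>p\<in>G. ad_term v \<alpha> p x)"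
    "finite H" "ad_support v \<alpha> y \<subseteq> H" "H \<subseteq> {(i, j). i < j}" "c = (\<Oplus>\<^bsub>Cl\<^esub>p\<in>H. ad_term v \<alpha> p y)"
    using assms(3,4) unfolding has_ad_sum_def by blast
  moreover from this have "b = (\<Oplus>\<^bsub>Cl\<^esub>p\<in>G \<union> H. ad_term v \<alpha> p x)"
      "c = (\<Oplus>\<^bsub>Cl\<^esub>p\<in>G \<union> H. ad_term v \<alpha> p y)"
    using ad_sum_superset[OF assms(1), of G v \<alpha>] ad_sum_superset[OF assms(1), of "G \<union> H" v \<alpha>]
      ad_sum_superset[OF assms(2), of H v \<alpha>] ad_sum_superset[OF assms(2), of "G \<union> H" v \<alpha>]
    by (simp_all add: le_supI1 le_supI2)
  ultimately show thesis
    by (intro that[of "G \<union> H"]) auto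
qed

lemma has_ad_sum_add:
  assumes D: "derivation D" and x: "x \<in> carrier Cl" and y: "y \<in> carrier Cl"
    and "has_ad_sum v \<alpha> x (D x)" "has_ad_sum v \<alpha> y (D y)"
  shows "has_ad_sum v \<alpha> (x \<oplus>\<^bsub>Cl\<^esub> y) (D (x \<oplus>\<^bsub>Cl\<^esub> y))"
proof -
  obtain F where F: "finite F" "F \<subseteq> {(i, j). i < j}" "ad_support v \<alpha> x \<subseteq> F" "ad_support v \<alpha> y \<subseteq> F"
    and sums: "D x = (\<Oplus>\<^bsub>Cl\<^esub>p\<in>F. ad_term v \<alpha> p x)" "D y = (\<Oplus>\<^bsub>Cl\<^esub>p\<in>F. ad_term v \<alpha> p y)"
    using has_ad_sum_common[OF x y assms(4,5)] by metis
  have split: "ad_term v \<alpha> p (x \<oplus>\<^bsub>Cl\<^esub> y) = ad_term v \<alpha> p x \<oplus>\<^bsub>Cl\<^esub> ad_term v \<alpha> p y" for p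
    by (rule derivation_add[OF derivation_ad_term x y])
  have "ad_support v \<alpha> (x \<oplus>\<^bsub>Cl\<^esub> y) \<subseteq> F"
    using F(3,4) unfolding ad_support_subset_iff by (simp add: split)
  moreover have "D (x \<oplus>\<^bsub>Cl\<^esub> y) = (\<Oplus>\<^bsub>Cl\<^esub>p\<in>F. ad_term v \<alpha> p (x \<oplus>\<^bsub>Cl\<^esub> y))"
    using x y by (simp add: derivation_add[OF D] sums split Cl.finsum_addf)
  ultimately show ?thesis
    unfolding has_ad_sum_def using F(1,2) by blast
qed

lemma has_ad_sum_mult:
  assumes D: "derivation D" and x: "x \<in> carrier Cl" and y: "y \<in> carrier Cl"
    and "has_ad_sum v \<alpha> x (D x)" "has_ad_sum v \<alpha> y (D y)"
  shows "has_ad_sum v \<alpha> (x \<otimes>\<^bsub>Cl\<^esub> y) (D (x \<otimes>\<^bsub>Cl\<^esub> y))"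
proof -
  obtain F where F: "finite F" "F \<subseteq> {(i, j). i < j}" "ad_support v \<alpha> x \<subseteq> F" "ad_support v \<alpha> y \<subseteq> F"
    and sums: "D x = (\<Oplus>\<^bsub>Cl\<^esub>p\<in>F. ad_term v \<alpha> p x)" "D y = (\<Oplus>\<^bsub>Cl\<^esub>p\<in>F. ad_term v \<alpha> p y)"
    using has_ad_sum_common[OF x y assms(4,5)] by metis
  have split: "ad_term v \<alpha> p (x \<otimes>\<^bsub>Cl\<^esub> y)
      = ad_term v \<alpha> p x \<otimes>\<^bsub>Cl\<^esub> y \<oplus>\<^bsub>Cl\<^esub> x \<otimes>\<^bsub>Cl\<^esub> ad_term v \<alpha> p y" for p
    by (rule derivation_mult[OF derivation_ad_term x y])
  have "ad_support v \<alpha> (x \<otimes>\<^bsub>Cl\<^esub> y) \<subseteq> F"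
    using F(3,4) x y unfolding ad_support_subset_iff by (simp add: split)
  moreover have "D (x \<otimes>\<^bsub>Cl\<^esub> y) = (\<Oplus>\<^bsub>Cl\<^esub>p\<in>F. ad_term v \<alpha> p (x \<otimes>\<^bsub>Cl\<^esub> y))"
    using x y F(1)
    by (simp add: derivation_mult[OF D] sums split Cl.finsum_addf Cl.finsum_ldistr Cl.finsum_rdistr)
  ultimately show ?thesis
    unfolding has_ad_sum_def using F(1,2) by blast
qed

lemma has_ad_sum_const:
  assumes "derivation D"
  shows "has_ad_sum v \<alpha> (const c) (D (const c))"
  unfolding has_ad_sum_def
  by (intro exI[of _ "{}"])
    (auto simp: ad_support_def derivation_const[OF assms] derivation_const[OF derivation_ad_term])

text \<open>
  The elements at which the ad-sum is locally finite and equals \<open>D\<close> form a subalgebra, since both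
  sides obey the Leibniz rule. It contains the basis vectors, hence \<open>V\<close>, hence everything.
\<close>

lemma is_ad_sum_from_basis:
  assumes D: "derivation D" and span: "span (range v) = UNIV"
    and basis: "\<And>k. has_ad_sum v \<alpha> (\<iota> (v k)) (D (\<iota> (v k)))"
  shows "is_ad_sum v \<alpha> D"
proof -
  have iota: "has_ad_sum v \<alpha> (\<iota> w) (D (\<iota> w))" for w
  proof -
    have "w \<in> span (range v)" by (simp add: span)
    then show ?thesis
    proof (induction rule: span_induct_alt)
      case base
      then show ?case
        using has_ad_sum_const[OF D, of v \<alpha> 0] by (simp only: iota_zero const_zero)
    next
      case (step c x y)
      from step(1) obtain k where x: "x = v k" by auto
      show ?case
        unfolding x iota_add iota_scale Cl_scale_def
        by (intro has_ad_sum_add[OF D] has_ad_sum_mult[OF D] has_ad_sum_const[OF D] basis step(2)) simp_all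
    qed
  qed
  have "has_ad_sum v \<alpha> x (D x)" if "x \<in> carrier Cl" for x
    using that
    by (induction rule: Cl_induct)
      (auto intro: iota has_ad_sum_const has_ad_sum_add has_ad_sum_mult D)
  then show ?thesis by (simp add: is_ad_sum_iff)
qed

lemma has_ad_sum_iota:
  assumes "has_ad_sum v \<alpha> (\<iota> u) b"
  obtains w where "b = \<iota> w"
  using assms unfolding has_ad_sum_def finsum_ad_term_iota by blast

section \<open>Coefficients in an orthonormal basis\<close>

text \<open>
  Orthonormality, which is a condition on the Clifford algebra, becomes one on the bilinear form
  by injectivity of the scalars. The diagonal value is 2 because \<open>polar_form f x x = 2 f x\<close>.
\<close>

lemma orthonormal_polar:
  assumes "\<one>\<^bsub>Cl\<^esub> \<noteq> \<zero>\<^bsub>Cl\<^esub>" "orthonormal_basis v"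
  shows "polar_form f (v i) (v j) = (if i = j then 2 else 0)"
proof -
  have "const (polar_form f (v i) (v j)) = const (2 * (if i = j then 1 else 0))"
    using assms(2) iota_anticommutator[of "v i" "v j"] unfolding orthonormal_basis_def by metis
  then show ?thesis
    using assms(1) by (simp add: const_inject split: if_splits)
qed

text \<open>
  A coefficient is recovered from \<open>D\<close> by pairing: \<open>D v\<^sub>k\<close> is the sum of \<open>2 \<alpha>\<^bsub>ik\<^esub> v\<^sub>i\<close> over \<open>i < k\<close> minus
  the sum of \<open>2 \<alpha>\<^bsub>kj\<^esub> v\<^sub>j\<close> over \<open>j > k\<close>, and its anticommutator with \<open>v\<^sub>i\<close> is its polar product with
  \<open>v\<^sub>i\<close>, in which only the summand of \<open>v\<^sub>i\<close> survives and is doubled once more.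
\<close>

lemma ad_sum_coefficient:
  assumes nontriv: "\<one>\<^bsub>Cl\<^esub> \<noteq> \<zero>\<^bsub>Cl\<^esub>" and v: "orthonormal_basis v"
    and D: "is_ad_sum v \<alpha> D" and "i < k"
  shows "\<iota> (v i) \<otimes>\<^bsub>Cl\<^esub> D (\<iota> (v k)) \<oplus>\<^bsub>Cl\<^esub> D (\<iota> (v k)) \<otimes>\<^bsub>Cl\<^esub> \<iota> (v i) = const (4 * \<alpha> i k)"
proof -
  define b where "b = ad_vector v \<alpha> (v k)"
  \<comment> \<open>the pair \<open>(i, k)\<close> lies outside the support when its coefficient vanishes\<close>
  define S where "S = insert (i, k) (ad_support v \<alpha> (\<iota> (v k)))"
  have fin: "finite S" and less: "S \<subseteq> {(p, q). p < q}"
    using D \<open>i < k\<close> by (auto simp: S_def is_ad_sum_def ad_support_def)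
  have "D (\<iota> (v k)) = (\<Oplus>\<^bsub>Cl\<^esub>p\<in>S. ad_term v \<alpha> p (\<iota> (v k)))"
    using D ad_sum_superset[OF proj_closed fin _ less, of v \<alpha>]
    by (auto simp: is_ad_sum_def S_def)
  then have "D (\<iota> (v k)) = \<iota> (sum b S)"
    by (simp only: finsum_ad_term_iota b_def)
  moreover have "polar_form f (v i) (sum b S) = (\<Sum>p\<in>S. if p = (i, k) then 4 * \<alpha> i k else 0)"
    unfolding polar.sum
  proof (rule sum.cong[OF refl])
    fix p assume "p \<in> S"
    moreover obtain p1 p2 where "p = (p1, p2)" by fastforce
    ultimately show "polar_form f (v i) (b p) = (if p = (i, k) then 4 * \<alpha> i k else 0)"
      using less \<open>i < k\<close>
      by (auto simp: b_def ad_vector_def polar.scale polar.diff orthonormal_polar[OF nontriv v])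
  qed
  moreover have "\<dots> = 4 * \<alpha> i k"
    using fin by (simp add: S_def)
  ultimately show ?thesis by (simp add: iota_anticommutator)
qed

lemma ad_sum_unique:
  assumes "\<one>\<^bsub>Cl\<^esub> \<noteq> \<zero>\<^bsub>Cl\<^esub>" "orthonormal_basis v" "(2 :: 'k) \<noteq> 0"
    and "is_ad_sum v \<alpha> D" "is_ad_sum v \<beta> D" "i < j"
  shows "\<alpha> i j = \<beta> i j"
proof -
  have "const (4 * \<alpha> i j) = const (4 * \<beta> i j)"
    using ad_sum_coefficient[OF assms(1,2) _ assms(6)] assms(4,5) by metis
  then have "2 * (2 * \<alpha> i j) = 2 * (2 * \<beta> i j)"
    using assms(1) by (simp add: const_inject)
  then show ?thesis using assms(3) by (metis mult_left_cancel)
qed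

text \<open>
  Fourier expansion: the coefficient of \<open>v\<^sub>i\<close> is \<open>polar_form f v\<^sub>i w / 2\<close> since \<open>v\<^sub>i\<close> has polar square 2.
  The index set may be any finite set that contains the nonzero coefficients.
\<close>

lemma orthonormal_expansion:
  assumes "\<one>\<^bsub>Cl\<^esub> \<noteq> \<zero>\<^bsub>Cl\<^esub>" "orthonormal_basis v" "(2 :: 'k) \<noteq> 0"
  shows finite_polar_support: "finite {i. polar_form f (v i) w \<noteq> 0}"
    and "\<lbrakk>finite F; {i. polar_form f (v i) w \<noteq> 0} \<subseteq> F\<rbrakk>
      \<Longrightarrow> w = (\<Sum>i\<in>F. (polar_form f (v i) w / 2) *s v i)"
proof -
  have inj: "inj v" and "w \<in> span (range v)"
    using assms(2) by (auto simp: orthonormal_basis_def)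
  then obtain t r where t: "finite t" "t \<subseteq> range v" "w = (\<Sum>a\<in>t. r a *s a)"
    unfolding span_explicit by auto
  then obtain G where G: "finite G" "t = v ` G"
    by (meson finite_subset_image)
  have w: "w = (\<Sum>i\<in>G. r (v i) *s v i)"
    unfolding t(3) G(2) using inj by (subst sum.reindex) (auto intro: inj_on_subset)
  have coeff: "polar_form f (v i) w = (if i \<in> G then 2 * r (v i) else 0)" for i
  proof -
    have "polar_form f (v i) w = (\<Sum>j\<in>G. if i = j then 2 * r (v j) else 0)"
      unfolding w polar.sum
      by (intro sum.cong) (auto simp: polar.scale orthonormal_polar[OF assms(1,2)])
    then show ?thesis using G(1) by simp
  qed
  show "finite {i. polar_form f (v i) w \<noteq> 0}"
    using G(1) by (rule finite_subset[rotated]) (auto simp: coeff split: if_splits)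
  assume F: "finite F" "{i. polar_form f (v i) w \<noteq> 0} \<subseteq> F"
  have "w = (\<Sum>i\<in>G. (polar_form f (v i) w / 2) *s v i)"
    using assms(3) by (subst w) (intro sum.cong, auto simp: coeff)
  also have "\<dots> = (\<Sum>i\<in>F \<union> G. (polar_form f (v i) w / 2) *s v i)"
    using F G(1) by (intro sum.mono_neutral_left) (auto simp: coeff)
  also have "\<dots> = (\<Sum>i\<in>F. (polar_form f (v i) w / 2) *s v i)"
    using F G(1) by (intro sum.mono_neutral_right) auto
  finally show "w = (\<Sum>i\<in>F. (polar_form f (v i) w / 2) *s v i)" .
qed

section \<open>Bogolyubov derivations\<close>

text \<open>
  The coefficients forced by the pairing formula, \<open>\<alpha>\<^bsub>ij\<^esub> = polar_form f v\<^sub>i (\<psi> v\<^sub>j) / 4\<close>, work. For fixed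
  \<open>j\<close> they vanish for almost all \<open>i\<close>, because \<open>\<psi> v\<^sub>j\<close> is a finite combination of basis vectors;
  skew-symmetry of \<open>\<psi>\<close> makes the matrix antisymmetric, which turns this finiteness of columns into
  the required finiteness of rows and supplies the entries below the diagonal.
\<close>

lemma bogolyubov_imp_ad_sum:
  assumes nontriv: "\<one>\<^bsub>Cl\<^esub> \<noteq> \<zero>\<^bsub>Cl\<^esub>" and v: "orthonormal_basis v" and two: "(2 :: 'k) \<noteq> 0"
    and "bogolyubov D"
  shows "\<exists>\<alpha>. row_finite \<alpha> \<and> is_ad_sum v \<alpha> D"
proof -
  obtain \<psi> where D: "derivation D" and skew: "skew_symmetric \<psi>" and \<psi>: "\<And>w. D (\<iota> w) = \<iota> (\<psi> w)"
    using \<open>bogolyubov D\<close> unfolding bogolyubov_def by blast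
  define c where "c i j = polar_form f (v i) (\<psi> (v j))" for i j
  have anti: "c i j = - c j i" for i j
    using skew unfolding skew_symmetric_def c_def
    by (metis add.commute eq_neg_iff_add_eq_0 polar_commute)
  have diag: "c i i = 0" for i
  proof -
    have "2 * c i i = 0" using anti[of i i] by simp
    then show ?thesis using two by simp
  qed
  have fin: "finite {i. c i k \<noteq> 0}" for k
    unfolding c_def using finite_polar_support[OF nontriv v two] .
  define \<alpha> where "\<alpha> i j = c i j / 4" for i j
  have double: "\<alpha> i j * 2 = c i j / 2" for i j
  proof -
    have "(2 :: 'k) * 2 \<noteq> 0" using two by (metis mult_eq_0_iff)
    then have "(4 :: 'k) \<noteq> 0" by simp
    then show ?thesis using two by (simp add: \<alpha>_def divide_simps)
  qed
  have "row_finite \<alpha>"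
    unfolding row_finite_def
  proof
    fix i
    show "finite {j. i < j \<and> \<alpha> i j \<noteq> 0}"
      by (rule finite_subset[OF _ fin[of i]]) (auto simp: \<alpha>_def anti[of i])
  qed
  moreover have "has_ad_sum v \<alpha> (\<iota> (v k)) (D (\<iota> (v k)))" for k
  proof -
    define b where "b = ad_vector v \<alpha> (v k)"
    \<comment> \<open>a pair acts nontrivially on \<open>v k\<close> only if it contains \<open>k\<close>; it is indexed by its other member\<close>
    define e where "e i = (min i k, max i k)" for i
    define G where "G = {..<k} \<union> {i. k < i \<and> c i k \<noteq> 0}"
    have finG: "finite G"
      using fin[of k] by (auto simp: G_def)
    have "{i. polar_form f (v i) (\<psi> (v k)) \<noteq> 0} \<subseteq> G"
      using diag[of k] by (auto simp: G_def c_def[symmetric]) (metis linorder_neqE_nat)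
    then have "\<psi> (v k) = (\<Sum>i\<in>G. (c i k / 2) *s v i)"
      using orthonormal_expansion(2)[OF nontriv v two finG] by (simp add: c_def)
    also have "\<dots> = (\<Sum>i\<in>G. b (e i))"
    proof (rule sum.cong[OF refl])
      fix i assume "i \<in> G"
      then consider "i < k" | "k < i" by (auto simp: G_def)
      then show "(c i k / 2) *s v i = b (e i)"
      proof cases
        case 1
        then show ?thesis
          using two by (simp add: b_def ad_vector_def e_def double orthonormal_polar[OF nontriv v])
      next
        case 2
        then show ?thesis
          using two by (simp add: b_def ad_vector_def e_def double orthonormal_polar[OF nontriv v] anti[of k i])
      qed
    qed
    also have "\<dots> = (\<Sum>p\<in>e ` G. b p)"
    proof -
      have "inj_on e G" by (auto simp: inj_on_def e_def min_def max_def split: if_splits)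
      then show ?thesis by (simp add: sum.reindex)
    qed
    finally have "D (\<iota> (v k)) = (\<Oplus>\<^bsub>Cl\<^esub>p\<in>e ` G. ad_term v \<alpha> p (\<iota> (v k)))"
      by (simp add: \<psi> finsum_ad_term_iota b_def)
    moreover have "ad_support v \<alpha> (\<iota> (v k)) \<subseteq> e ` G"
    proof
      fix p assume "p \<in> ad_support v \<alpha> (\<iota> (v k))"
      moreover obtain i j where p: "p = (i, j)" by fastforce
      ultimately have "i < j" and nz: "\<iota> (b (i, j)) \<noteq> \<zero>\<^bsub>Cl\<^esub>"
        by (auto simp: ad_support_def ad_term_iota b_def)
      then have "b (i, j) \<noteq> 0" using iota_zero by metis
      then have "i = k \<or> j = k" "\<alpha> i j \<noteq> 0"
        by (auto simp: b_def ad_vector_def orthonormal_polar[OF nontriv v] split: if_splits)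
      then show "p \<in> e ` G"
      proof (elim disjE)
        assume "i = k"
        then have "p = e j" "j \<in> G"
          using \<open>i < j\<close> \<open>\<alpha> i j \<noteq> 0\<close> anti[of i j] by (auto simp: p e_def G_def \<alpha>_def)
        then show ?thesis by blast
      next
        assume "j = k"
        then have "p = e i" "i \<in> G"
          using \<open>i < j\<close> by (auto simp: p e_def G_def)
        then show ?thesis by blast
      qed
    qed
    moreover have "e ` G \<subseteq> {(i, j). i < j}"
      by (auto simp: e_def G_def)
    ultimately show ?thesis
      unfolding has_ad_sum_def using finG by blast
  qed
  ultimately show ?thesis
    using is_ad_sum_from_basis[OF D] v unfolding orthonormal_basis_def by blast
qed

text \<open>
  Each \<open>ad (v\<^sub>i v\<^sub>j)\<close> maps \<open>V\<close> into \<open>V\<close>, hence so does \<open>D\<close>. As \<open>V\<close> embeds in the Clifford algebra, the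
  restriction is a linear map \<open>\<psi>\<close>. Applying \<open>D\<close> to \<open>x y + y x = polar_form f x y\<close>, whose right side
  is a constant and so is killed, says exactly that \<open>\<psi>\<close> is skew-symmetric.
\<close>

lemma ad_sum_imp_bogolyubov:
  assumes nontriv: "\<one>\<^bsub>Cl\<^esub> \<noteq> \<zero>\<^bsub>Cl\<^esub>" and "nondegenerate"
    and D: "derivation D" and "is_ad_sum v \<alpha> D"
  shows "bogolyubov D"
proof -
  have inject: "\<iota> x = \<iota> y \<longleftrightarrow> x = y" for x y
    using iota_inject[OF assms(1,2)] .
  have "\<exists>w. D (\<iota> x) = \<iota> w" for x
    using assms(4) has_ad_sum_iota[of v \<alpha> x "D (\<iota> x)"] by (metis is_ad_sum_iff proj_closed)
  then obtain \<psi> where \<psi>: "\<And>x. D (\<iota> x) = \<iota> (\<psi> x)" by metis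
  have "Vector_Spaces.linear scale scale \<psi>"
  proof unfold_locales
    fix x y
    have "\<iota> (\<psi> (x + y)) = \<iota> (\<psi> x + \<psi> y)"
      by (simp add: iota_add derivation_add[OF D] flip: \<psi>)
    then show "\<psi> (x + y) = \<psi> x + \<psi> y" by (simp only: inject)
  next
    fix c x
    have "\<iota> (\<psi> (c *s x)) = \<iota> (c *s \<psi> x)"
      by (simp add: iota_scale derivation_scale[OF D] flip: \<psi>)
    then show "\<psi> (c *s x) = c *s \<psi> x" by (simp only: inject)
  qed
  moreover have "polar_form f (\<psi> x) y + polar_form f x (\<psi> y) = 0" for x y
  proof -
    have "const (polar_form f (\<psi> x) y + polar_form f x (\<psi> y))
        = (\<iota> (\<psi> x) \<otimes>\<^bsub>Cl\<^esub> \<iota> y \<oplus>\<^bsub>Cl\<^esub> \<iota> x \<otimes>\<^bsub>Cl\<^esub> \<iota> (\<psi> y))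
          \<oplus>\<^bsub>Cl\<^esub> (\<iota> (\<psi> y) \<otimes>\<^bsub>Cl\<^esub> \<iota> x \<oplus>\<^bsub>Cl\<^esub> \<iota> y \<otimes>\<^bsub>Cl\<^esub> \<iota> (\<psi> x))"
      unfolding const_add iota_anticommutator[symmetric]
      by (simp only: proj_add proj_mult) (simp add: algebra_simps)
    also have "\<dots> = D (\<iota> x \<otimes>\<^bsub>Cl\<^esub> \<iota> y \<oplus>\<^bsub>Cl\<^esub> \<iota> y \<otimes>\<^bsub>Cl\<^esub> \<iota> x)"
      by (simp add: derivation_add[OF D] derivation_mult[OF D] \<psi>)
    also have "\<dots> = const 0"
      by (simp add: iota_anticommutator derivation_const[OF D] const_zero)
    finally show ?thesis
      using const_inject[OF nontriv] by blast
  qed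
  ultimately show ?thesis
    unfolding bogolyubov_def skew_symmetric_def using D \<psi> by blast
qed

end

lemma two_neq_zero_if_CHAR_neq_2:
  assumes "CHAR('k::field) \<noteq> 2"
  shows "(2 :: 'k) \<noteq> 0"
proof
  assume "(2 :: 'k) = 0"
  then have "CHAR('k) dvd 2"
    using of_nat_eq_0_iff_char_dvd[of 2, where ?'a = 'k] by simp
  then have "CHAR('k) \<le> 2" "CHAR('k) \<noteq> 0"
    by (auto dest: dvd_imp_le intro!: Nat.gr0I)
  moreover have "CHAR('k) \<noteq> 1" by simp
  ultimately show False using assms by linarith
qed

theorem theorem3:
  fixes scale :: "'k::alg_closed_field \<Rightarrow> 'v::ab_group_add \<Rightarrow> 'v"
    and f :: "'v \<Rightarrow> 'k"
    and v :: "nat \<Rightarrow> 'v"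
    and D :: "('v, 'k) free_algebra set \<Rightarrow> ('v, 'k) free_algebra set"
  assumes "CHAR('k) \<noteq> 2"
    and "quadratic_space scale f"
    and "quadratic_space.countably_infinite_dimensional scale"
    and "quadratic_space.nondegenerate f"
    and "quadratic_space.orthonormal_basis scale f v"
    and "quadratic_space.even_derivation scale f D"
    and "\<exists>a\<in>carrier (quadratic_space.Cl scale f). D a \<noteq> \<zero>\<^bsub>quadratic_space.Cl scale f\<^esub>"
  shows "(quadratic_space.bogolyubov scale f D \<longleftrightarrow>
            (\<exists>\<alpha>. row_finite \<alpha> \<and> quadratic_space.is_ad_sum scale f v \<alpha> D)) \<and>
         (\<forall>\<alpha> \<beta>. row_finite \<alpha> \<and> quadratic_space.is_ad_sum scale f v \<alpha> D \<and>
                 row_finite \<beta> \<and> quadratic_space.is_ad_sum scale f v \<beta> D \<longrightarrow>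
                 (\<forall>i j. i < j \<longrightarrow> \<alpha> i j = \<beta> i j))"
proof -
  interpret quadratic_space scale f by (rule assms(2))
  interpret Cl: ring Cl by (rule ring_Cl)
  have D: "derivation D"
    using assms(6) by (simp add: even_derivation_def)
  \<comment> \<open>the zero ring has only the zero derivation\<close>
  have "\<one>\<^bsub>Cl\<^esub> \<noteq> \<zero>\<^bsub>Cl\<^esub>"
  proof
    assume "\<one>\<^bsub>Cl\<^esub> = \<zero>\<^bsub>Cl\<^esub>"
    then have "carrier Cl = {\<zero>\<^bsub>Cl\<^esub>}" using Cl.one_zeroD by blast
    then show False
      using assms(7) derivation_closed[OF D] by blast
  qed
  then show ?thesis
    using bogolyubov_imp_ad_sum[OF _ assms(5) two_neq_zero_if_CHAR_neq_2[OF assms(1)]]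
      ad_sum_imp_bogolyubov[OF _ assms(4) D]
      ad_sum_unique[OF _ assms(5) two_neq_zero_if_CHAR_neq_2[OF assms(1)]]
    by metis
qed

end
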